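(* Let $r\ge 0$ and $a\ge1$ be integers, and let $\varphi=\nu\lambda^{-1}$ be the bijection from monomials of degree at most $a$ in $w_1,\dots,w_r$ to $a$-element subsets of $[r+a]$ defined via lattice paths, with inverse $\psi$. (a) The map $\varphi$ induces (by taking images $\mathrm M\mapsto\overline\varphi(\mathrm M)=\{\varphi(m):m\in \mathrm M\}$) a bijection $\overline{\varphi}$, with inverse $\overline{\psi}$ (taking images under $\psi$), between shifted multicomplexes on $\{w_1,\dots,w_r\}$ all of whose monomials have degree at most $a$, and shifted families of $a$-element subsets of $[r+a]$. (b) For a pure shifted $(a-1)$-dimensional simplicial complex $\Delta$ on $[r+a]$ with set of facets $\mathcal F(\Delta)$, one has $\mathrm h(\Delta)=\mathrm f(\overline{\psi}(\mathcal F(\Delta)))$; that is, for each $0\le i\le a$, $h_i(\Delta)$ equals the number of monomials of degree $i$ in $\overline\psi(\mathcal F(\Delta))$.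
   Context: **Lattice paths.** $\mathcal L_{r,a}$ is the set of lattice paths from $(0,0)$ to $(r,a)$ with unit east (E) and north (N) steps, written as words $L=L_1\cdots L_{r+a}$ in $\{N,E\}$ with exactly $a$ letters $N$. Put $\nu(L)=\{i: L_i=N\}$, an $a$-element subset of $[r+a]=\{1,\dots,r+a\}$, and $\lambda(L)=\prod_{i=1}^r w_i^{\lambda_i(L)}$, where $\lambda_i(L)$ is the number of north steps of $L$ of the form $(i-1,j)\to(i-1,j+1)$. Both $\nu$ (onto $a$-subsets of $[r+a]$) and $\lambda$ (onto monomials of degree at most $a$ in $w_1,\dots,w_r$) are bijections. **Multicomplexes.** A multicomplex on a set of variables is a collection of monomials in these variables closed under divisibility. A multicomplex $\mathrm M$ on $\{w_1,\dots,w_r\}$ is shifted if for all $p<q$ and all $m\in \mathrm M$ divisible by $w_p$, one has $w_q\cdot(m/w_p)\in \mathrm M$. Its $f$-vector is $\mathrm f(\mathrm M)=(f_0,f_1,\dots)$ with $f_i$ the number of monomials of degree $i$ in $\mathrm M$. **Set families and complexes.** A family $\mathcal A$ of subsets of $[n]$ is shifted if for all $1\le p<q\le n$ and all $F\in\mathcal A$ with $p\in F$, $q\notin F$, one has $(F\setminus\{p\})\cup\{q\}\in\mathcal A$. A simplicial complex on $[n]$ (a family of subsets closed under taking subsets) is shifted if it is a shifted family; it is pure of dimension $a-1$ if all its facets (inclusion-maximal faces) have cardinality $a$. The $h$-vector of an $(a-1)$-dimensional complex $\Delta$ with $f_i$ faces of dimension $i$ (cardinality $i+1$) is defined by $\sum_{i=0}^a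 h_iy^i=\sum_{i=0}^a f_{i-1}(1-y)^{a-i}y^i$. *)

theory Defs
  imports Complex_Main "HOL-Library.Multiset" "HOL-Computational_Algebra.Polynomial"
begin

section \<open>Lattice paths\<close>

datatype step = North | East

definition lattice_paths :: "nat \<Rightarrow> nat \<Rightarrow> step list set" where
  "lattice_paths r a = {L. length L = r + a \<and> count_list L North = a}"

text \<open>Words are indexed from 1 in the mathematics, whereas list positions start at 0; hence the
  shift by one in \<open>nu\<close>. The step at list position \<open>k\<close> starts at the abscissa
  \<open>count_list (take k L) East\<close>.\<close>

definition nu :: "step list \<Rightarrow> nat set" where
  "nu L = {i \<in> {1..length L}. L ! (i - 1) = North}"

definition north_steps :: "step list \<Rightarrow> nat \<Rightarrow> nat" where
  "north_steps L i = card {k. k < length L \<and> L ! k = North \<and> count_list (take k L) East + 1 = i}"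

text \<open>A monomial in $w_1, \dots, w_r$ is encoded as the multiset of the indices of its variables:
  the exponent of $w_i$ is \<open>count m i\<close>, the degree is \<open>size m\<close>, the product is \<open>+\<close>, and
  divisibility is \<open>\<subseteq>#\<close>. North steps on the final line \<open>x = r\<close> do not contribute to \<open>lambda\<close>.\<close>

definition lambda :: "nat \<Rightarrow> step list \<Rightarrow> nat multiset" where
  "lambda r L = (\<Sum>i=1..r. replicate_mset (north_steps L i) i)"

definition monomials :: "nat \<Rightarrow> nat multiset set" where
  "monomials r = {m. set_mset m \<subseteq> {1..r}}"

definition monomials_upto :: "nat \<Rightarrow> nat \<Rightarrow> nat multiset set" where
  "monomials_upto r a = {m \<in> monomials r. size m \<le> a}"

definition subsets_of_card :: "nat \<Rightarrow> nat \<Rightarrow> nat set set" where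
  "subsets_of_card n a = {F. F \<subseteq> {1..n} \<and> card F = a}"

text \<open>That \<open>inv_into\<close> yields genuine inverses here is shown in \<open>bij_betw_lambda\<close> and
  \<open>bij_betw_phi\<close> below.\<close>

definition phi :: "nat \<Rightarrow> nat \<Rightarrow> nat multiset \<Rightarrow> nat set" where
  "phi r a m = nu (inv_into (lattice_paths r a) (lambda r) m)"

definition psi :: "nat \<Rightarrow> nat \<Rightarrow> nat set \<Rightarrow> nat multiset" where
  "psi r a = inv_into (monomials_upto r a) (phi r a)"

definition phi_bar :: "nat \<Rightarrow> nat \<Rightarrow> nat multiset set \<Rightarrow> nat set set" where
  "phi_bar r a M = phi r a ` M"

definition psi_bar :: "nat \<Rightarrow> nat \<Rightarrow> nat set set \<Rightarrow> nat multiset set" where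
  "psi_bar r a A = psi r a ` A"

section \<open>Multicomplexes\<close>

definition multicomplex :: "nat \<Rightarrow> nat multiset set \<Rightarrow> bool" where
  "multicomplex r M \<longleftrightarrow> M \<subseteq> monomials r \<and> (\<forall>m\<in>M. \<forall>m'. m' \<subseteq># m \<longrightarrow> m' \<in> M)"

definition shifted_multicomplex :: "nat \<Rightarrow> nat multiset set \<Rightarrow> bool" where
  "shifted_multicomplex r M \<longleftrightarrow> multicomplex r M \<and>
     (\<forall>p\<in>{1..r}. \<forall>q\<in>{1..r}. p < q \<longrightarrow> (\<forall>m\<in>M. p \<in># m \<longrightarrow> add_mset q (m - {#p#}) \<in> M))"

definition shifted_multicomplexes_upto :: "nat \<Rightarrow> nat \<Rightarrow> nat multiset set set" where
  "shifted_multicomplexes_upto r a = {M. shifted_multicomplex r M \<and> (\<forall>m\<in>M. size m \<le> a)}"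

definition f_vector :: "nat multiset set \<Rightarrow> nat \<Rightarrow> nat" where
  "f_vector M i = card {m \<in> M. size m = i}"

section \<open>Set families and simplicial complexes\<close>

definition shifted_family :: "nat \<Rightarrow> nat set set \<Rightarrow> bool" where
  "shifted_family n A \<longleftrightarrow> A \<subseteq> Pow {1..n} \<and>
     (\<forall>p\<in>{1..n}. \<forall>q\<in>{1..n}. p < q \<longrightarrow>
        (\<forall>F\<in>A. p \<in> F \<and> q \<notin> F \<longrightarrow> insert q (F - {p}) \<in> A))"

definition shifted_families_of_card :: "nat \<Rightarrow> nat \<Rightarrow> nat set set set" where
  "shifted_families_of_card n a = {A. shifted_family n A \<and> A \<subseteq> subsets_of_card n a}"

definition simplicial_complex :: "nat \<Rightarrow> nat set set \<Rightarrow> bool" where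
  "simplicial_complex n \<Delta> \<longleftrightarrow> \<Delta> \<subseteq> Pow {1..n} \<and> (\<forall>F\<in>\<Delta>. \<forall>G. G \<subseteq> F \<longrightarrow> G \<in> \<Delta>)"

definition shifted_complex :: "nat \<Rightarrow> nat set set \<Rightarrow> bool" where
  "shifted_complex n \<Delta> \<longleftrightarrow> simplicial_complex n \<Delta> \<and> shifted_family n \<Delta>"

definition facets :: "nat set set \<Rightarrow> nat set set" where
  "facets \<Delta> = {F \<in> \<Delta>. \<forall>G\<in>\<Delta>. F \<subseteq> G \<longrightarrow> G = F}"

text \<open>In \<open>pure_complex\<close> and \<open>h_vector\<close>, \<open>a\<close> is the dimension plus one, i.e. the common
  cardinality of the facets; \<open>face_count \<Delta> i\<close> is $f_{i-1}(\Delta)$.\<close>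

definition pure_complex :: "nat \<Rightarrow> nat set set \<Rightarrow> bool" where
  "pure_complex a \<Delta> \<longleftrightarrow> (\<forall>F\<in>facets \<Delta>. card F = a)"

definition face_count :: "nat set set \<Rightarrow> nat \<Rightarrow> nat" where
  "face_count \<Delta> i = card {F \<in> \<Delta>. card F = i}"

text \<open>Here \<open>[:1, -1:]\<close> is $1 - y$ and \<open>[:0, 1:]\<close> is $y$.\<close>

definition h_polynomial :: "nat \<Rightarrow> nat set set \<Rightarrow> int poly" where
  "h_polynomial a \<Delta> = (\<Sum>i=0..a. of_nat (face_count \<Delta> i) * [:1, -1:] ^ (a - i) * [:0, 1:] ^ i)"

definition h_vector :: "nat \<Rightarrow> nat set set \<Rightarrow> nat \<Rightarrow> int" where
  "h_vector a \<Delta> i = coeff (h_polynomial a \<Delta>) i"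

section \<open>The maps are bijections\<close>

lemma length_eq_count_steps: "length L = count_list L North + count_list L East"
proof (induction L)
  case (Cons s L)
  then show ?case by (cases s) auto
qed simp

lemma lattice_paths_count_East: "L \<in> lattice_paths r a \<Longrightarrow> count_list L East = r"
  using length_eq_count_steps[of L] by (simp add: lattice_paths_def)

lemma card_positions_Cons:
  "card {k. k < length (s # L) \<and> P k} =
    (if P 0 then 1 else 0) + card {k. k < length L \<and> P (Suc k)}"
proof -
  have "{k. k < length (s # L) \<and> P k} =
      (if P 0 then {0} else {}) \<union> Suc ` {k. k < length L \<and> P (Suc k)}"
    by (auto simp: image_iff less_Suc_eq_0_disj)
  then show ?thesis
    by (simp add: card_image card_insert_if)
qed

lemma north_steps_Nil [simp]: "north_steps [] i = 0"
  by (simp add: north_steps_def)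

lemma north_steps_0 [simp]: "north_steps L 0 = 0"
  by (simp add: north_steps_def)

lemma north_steps_North [simp]:
  "north_steps (North # L) i = (if i = 1 then 1 else 0) + north_steps L i"
  unfolding north_steps_def card_positions_Cons by auto

lemma north_steps_East [simp]: "north_steps (East # L) i = north_steps L (i - 1)"
proof (cases i)
  case (Suc j)
  then show ?thesis
    unfolding north_steps_def card_positions_Cons by simp
qed simp

lemma sum_north_steps: "(\<Sum>i=1..Suc (count_list L East). north_steps L i) = count_list L North"
proof (induction L)
  case (Cons s L)
  show ?case
  proof (cases s)
    case North
    have "(\<Sum>i=1..Suc (count_list L East). (if i = 1 then 1 else 0 :: nat)) = 1"
      by (simp add: sum.delta)
    with Cons North show ?thesis
      by (simp add: sum.distrib del: sum.cl_ivl_Suc)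
  next
    case East
    have "(\<Sum>i=1..Suc (Suc (count_list L East)). north_steps L (i - 1)) =
        (\<Sum>i=0..Suc (count_list L East). north_steps L i)"
      using sum.shift_bounds_cl_Suc_ivl[of "\<lambda>i. north_steps L (i - 1)" 0
          "Suc (count_list L East)"]
      by (simp del: sum.cl_ivl_Suc)
    also have "\<dots> = (\<Sum>i=1..Suc (count_list L East). north_steps L i)"
      by (simp add: sum.atLeast_Suc_atMost del: sum.cl_ivl_Suc)
    finally show ?thesis
      using Cons East by (simp del: sum.cl_ivl_Suc)
  qed
qed simp

lemma north_steps_inject:
  assumes "length L = length L'" and "\<And>i. north_steps L i = north_steps L' i"
  shows "L = L'"
  using assms
proof (induction L L' rule: list_induct2)
  case (Cons s L s' L')
  have s: "s = s'"
    using Cons.prems[of 1] by (cases s; cases s') auto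
  have "north_steps L i = north_steps L' i" for i
  proof (cases s)
    case North
    with s Cons.prems[of i] show ?thesis by simp
  next
    case East
    with s Cons.prems[of "Suc i"] show ?thesis by simp
  qed
  with s Cons.IH show ?case by simp
qed simp

lemma north_steps_beyond: "Suc (count_list L East) < i \<Longrightarrow> north_steps L i = 0"
proof (induction L arbitrary: i)
  case (Cons s L)
  then show ?case by (cases s) auto
qed simp

lemma ex_path_north_steps:
  "\<exists>L. count_list L East = r \<and> (\<forall>i\<in>{1..Suc r}. north_steps L i = c i)"
proof (induction r arbitrary: c)
  case 0
  have "count_list (replicate n North) East = 0 \<and> north_steps (replicate n North) 1 = n" for n
    by (induction n) auto
  then show ?case by (intro exI[of _ "replicate (c 1) North"]) simp
next
  case (Suc r)
  obtain L where L: "count_list L East = r" "\<forall>i\<in>{1..Suc r}. north_steps L i = c (Suc i)"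
    using Suc[of "\<lambda>i. c (Suc i)"] by blast
  have *: "count_list (replicate n North @ East # L) East = Suc r \<and>
      (\<forall>i. north_steps (replicate n North @ East # L) i =
        (if i = 1 then n else north_steps L (i - 1)))" for n
    using L(1) by (induction n) auto
  have "(if i = 1 then c 1 else north_steps L (i - 1)) = c i" if "i \<in> {1..Suc (Suc r)}" for i
  proof (cases "i = 1")
    case False
    with that have "i - 1 \<in> {1..Suc r}" "Suc (i - 1) = i" by auto
    with L(2) False show ?thesis by metis
  qed simp
  with *[of "c 1"] show ?case
    by (intro exI[of _ "replicate (c 1) North @ East # L"] conjI ballI) metis+
qed

lemma count_lambda: "count (lambda r L) i = (if i \<in> {1..r} then north_steps L i else 0)"
  by (simp add: lambda_def count_sum if_distrib cong: if_cong)

lemma size_lambda: "size (lambda r L) = (\<Sum>i=1..r. north_steps L i)"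
  by (simp add: lambda_def size_multiset_sum)

lemma lambda_size_add:
  assumes "L \<in> lattice_paths r a"
  shows "size (lambda r L) + north_steps L (Suc r) = a"
  using sum_north_steps[of L] assms
  by (simp add: size_lambda lattice_paths_count_East[OF assms] lattice_paths_def)

theorem bij_betw_lambda: "bij_betw (lambda r) (lattice_paths r a) (monomials_upto r a)"
  unfolding bij_betw_def
proof (intro conjI set_eqI iffI)
  show "inj_on (lambda r) (lattice_paths r a)"
  proof (rule inj_onI)
    fix L L' assume L: "L \<in> lattice_paths r a" and L': "L' \<in> lattice_paths r a"
      and eq: "lambda r L = lambda r L'"
    have "north_steps L i = north_steps L' i" for i
    proof -
      consider "i = 0" | "i \<in> {1..r}" | "i = Suc r" | "Suc r < i" by fastforce
      then show ?thesis
      proof cases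
        case 2
        with eq count_lambda[of r L i] count_lambda[of r L' i] show ?thesis by simp
      next
        case 3
        with lambda_size_add[OF L] lambda_size_add[OF L'] eq show ?thesis by simp
      qed (simp_all add: north_steps_beyond lattice_paths_count_East[OF L]
          lattice_paths_count_East[OF L'])
    qed
    then show "L = L'"
      using L L' by (intro north_steps_inject) (simp_all add: lattice_paths_def)
  qed
next
  fix m assume "m \<in> lambda r ` lattice_paths r a"
  then obtain L where L: "L \<in> lattice_paths r a" "m = lambda r L" by blast
  have "set_mset m \<subseteq> {1..r}"
    by (auto simp: L(2) count_lambda set_mset_def split: if_splits)
  with lambda_size_add[OF L(1)] L(2) show "m \<in> monomials_upto r a"
    by (simp add: monomials_upto_def monomials_def)
next
  fix m assume "m \<in> monomials_upto r a"
  then have m: "set_mset m \<subseteq> {1..r}" "size m \<le> a"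
    by (simp_all add: monomials_upto_def monomials_def)
  obtain L where L: "count_list L East = r"
    "\<forall>i\<in>{1..Suc r}. north_steps L i = (if i = Suc r then a - size m else count m i)"
    using ex_path_north_steps[of r "\<lambda>i. if i = Suc r then a - size m else count m i"] by blast
  have eq: "lambda r L = m"
    using L(2) m(1) by (auto simp: multiset_eq_iff count_lambda not_in_iff[symmetric])
  have "(\<Sum>i=1..Suc r. north_steps L i) = size (lambda r L) + (a - size m)"
    using L(2) by (simp add: size_lambda)
  with m(2) eq sum_north_steps[of L] L(1) have "count_list L North = a" by simp
  with L(1) length_eq_count_steps[of L] have "L \<in> lattice_paths r a"
    by (simp add: lattice_paths_def)
  with eq show "m \<in> lambda r ` lattice_paths r a" by blast
qed

lemma card_nu: "card (nu L) = count_list L North"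
proof -
  have "nu L = Suc ` {k. k < length L \<and> L ! k = North}"
    by (force simp: nu_def image_iff Suc_le_eq gr0_conv_Suc)
  then have "card (nu L) = card {k. k < length L \<and> L ! k = North}"
    by (simp add: card_image)
  also have "\<dots> = count_list L North"
    by (simp add: count_list_eq_length_filter length_filter_conv_card eq_commute)
  finally show ?thesis .
qed

theorem bij_betw_nu: "bij_betw nu (lattice_paths r a) (subsets_of_card (r + a) a)"
  unfolding bij_betw_def
proof (intro conjI set_eqI iffI)
  show "inj_on nu (lattice_paths r a)"
  proof (rule inj_onI)
    fix L L' assume L: "L \<in> lattice_paths r a" "L' \<in> lattice_paths r a" "nu L = nu L'"
    show "L = L'"
    proof (rule nth_equalityI)
      show "length L = length L'" using L by (simp add: lattice_paths_def)
      fix k assume "k < length L"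
      with L(1,2) have "Suc k \<in> nu L \<longleftrightarrow> L ! k = North" "Suc k \<in> nu L' \<longleftrightarrow> L' ! k = North"
        by (simp_all add: nu_def lattice_paths_def)
      with L(3) show "L ! k = L' ! k" by (metis step.exhaust)
    qed
  qed
next
  fix F assume "F \<in> nu ` lattice_paths r a"
  then show "F \<in> subsets_of_card (r + a) a"
    by (auto simp: subsets_of_card_def lattice_paths_def card_nu) (auto simp: nu_def)
next
  fix F assume F: "F \<in> subsets_of_card (r + a) a"
  define L where "L = map (\<lambda>k. if Suc k \<in> F then North else East) [0..<r + a]"
  have "nu L = F"
  proof (intro set_eqI)
    fix i
    have "L ! (i - 1) = North \<longleftrightarrow> i \<in> F" if "i \<in> {1..r + a}"
    proof -
      from that have "i - 1 < r + a" "Suc (i - 1) = i" by auto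
      then show ?thesis by (simp add: L_def)
    qed
    moreover have "F \<subseteq> {1..r + a}" "length L = r + a"
      using F by (simp_all add: subsets_of_card_def L_def)
    ultimately show "i \<in> nu L \<longleftrightarrow> i \<in> F"
      by (auto simp: nu_def)
  qed
  moreover from this F card_nu[of L] have "L \<in> lattice_paths r a"
    by (simp add: lattice_paths_def subsets_of_card_def L_def)
  ultimately show "F \<in> nu ` lattice_paths r a" by blast
qed

theorem bij_betw_phi: "bij_betw (phi r a) (monomials_upto r a) (subsets_of_card (r + a) a)"
proof -
  have "phi r a = nu \<circ> inv_into (lattice_paths r a) (lambda r)"
    by (simp add: fun_eq_iff phi_def)
  then show ?thesis
    using bij_betw_trans[OF bij_betw_inv_into[OF bij_betw_lambda] bij_betw_nu] by simp
qed

end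

theory Submission
  imports Defs
begin

text \<open>
  Call the replacement of a factor \<open>NE\<close> of a lattice path by \<open>EN\<close> a flip. Both notions of
  shiftedness say the same thing about paths, namely closure under flips. Through \<open>nu\<close> a flip
  moves an element \<open>p\<close> to a vacant place \<open>p + 1\<close>, and any shift \<open>p \<rightarrow> q\<close> of a set is a composition
  of such moves (\<open>shifted_family_iff_adjacent\<close>). Through \<open>lambda\<close> a flip replaces one factor
  \<open>w\<^bsub>i\<^esub>\<close> by \<open>w\<^bsub>i+1\<^esub>\<close>, where \<open>w\<^bsub>r+1\<^esub>\<close> is read as \<open>1\<close>; these moves generate both the shifts and the
  divisors (\<open>shifted_multicomplex_iff_raise\<close>). So the images of a set of paths under \<open>lambda\<close>
  and \<open>nu\<close> are shifted simultaneously, which is the first part.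

  For the second part, let \<open>F\<close> be a facet and let its restriction \<open>R(F)\<close> be \<open>F\<close> without the
  longest final segment of the ground set contained in it. The intervals \<open>[R(F), F]\<close> partition
  a pure shifted complex (\<open>ex1_facet_interval\<close>): the only candidate for a face \<open>G\<close>
  is \<open>G\<close> filled up to size \<open>a\<close> by the largest available elements, and this set is a face because
  it arises by upward shifts from any facet containing \<open>G\<close>. Each interval contributes
  \<open>y\<^bsup>|R(F)|\<^esup>\<close> to the \<open>h\<close>-polynomial by the binomial theorem (\<open>h_vector_eq_card_restriction\<close>).
  The final segment consists of the north steps on the line \<open>x = r\<close>, exactly those that \<open>lambda\<close>
  ignores, so \<open>|R(F)|\<close> is the degree of the monomial of \<open>F\<close>.
\<close>

section \<open>Flips of lattice paths\<close>

definition flip :: "step list \<Rightarrow> step list \<Rightarrow> bool" where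
  "flip L L' \<longleftrightarrow> (\<exists>u v. L = u @ North # East # v \<and> L' = u @ East # North # v)"

definition flip_closed :: "step list set \<Rightarrow> bool" where
  "flip_closed P \<longleftrightarrow> (\<forall>L\<in>P. \<forall>L'. flip L L' \<longrightarrow> L' \<in> P)"

lemma flip_lattice_paths:
  "flip L L' \<Longrightarrow> L \<in> lattice_paths r a \<Longrightarrow> L' \<in> lattice_paths r a"
  by (auto simp: flip_def lattice_paths_def)

lemma nu_append: "nu (u @ v) = nu u \<union> (+) (length u) ` nu v"
proof (intro set_eqI)
  fix i
  have "i \<in> (+) (length u) ` nu v \<longleftrightarrow> length u \<le> i \<and> i - length u \<in> nu v"
    by (force simp: image_iff)
  then show "i \<in> nu (u @ v) \<longleftrightarrow> i \<in> nu u \<union> (+) (length u) ` nu v"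
    by (auto simp: nu_def nth_append)
qed

lemma nu_Cons: "nu (s # L) = (if s = North then {1} else {}) \<union> Suc ` nu L"
proof -
  have "nu [s] = (if s = North then {1} else {})"
    by (auto simp: nu_def)
  then show ?thesis
    using nu_append[of "[s]" L] by simp
qed

lemma nu_subset: "nu L \<subseteq> {1..length L}"
  by (auto simp: nu_def)

lemma nu_flip:
  "nu (u @ East # North # v)
    = insert (Suc (Suc (length u))) (nu (u @ North # East # v) - {Suc (length u)})"
  using nu_subset[of u] nu_subset[of v]
  by (auto simp: nu_append nu_Cons image_iff)

lemma path_split_nu:
  assumes "p \<in> nu L" "Suc p \<notin> nu L" "Suc p \<le> length L"
  obtains u v where "L = u @ North # East # v" "length u + 1 = p"
proof -
  from assms have p: "1 \<le> p" "L ! (p - 1) = North" "L ! p = East"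
    by (auto simp: nu_def intro: step.exhaust)
  have "L = take (p - 1) L @ L ! (p - 1) # drop p L"
    using id_take_nth_drop[of "p - 1" L] p assms(3) by simp
  also have "drop p L = L ! p # drop (Suc p) L"
    using Cons_nth_drop_Suc[of p L] assms(3) by simp
  finally have "L = take (p - 1) L @ North # East # drop (Suc p) L"
    using p by simp
  then show ?thesis
    using that p(1) assms(3) by (metis (no_types, lifting) Suc_leD diff_le_self le_add_diff_inverse2
      le_trans length_take min.absorb2)
qed

lemma north_steps_append:
  "north_steps (u @ v) i = north_steps u i + north_steps v (i - count_list u East)"
proof (induction u arbitrary: i)
  case (Cons s u)
  then show ?case by (cases s) auto
qed simp

text \<open>The last north step of a column that is not the final one is followed by an east step,
  so that every variable dividing the monomial of a path can be acted upon by a flip.\<close>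

lemma path_split_north_steps:
  assumes "north_steps L i > 0" "i \<le> count_list L East"
  shows "\<exists>u v. L = u @ North # East # v \<and> count_list u East + 1 = i"
  using assms
proof (induction L arbitrary: i)
  case (Cons s L)
  show ?case
  proof (cases s)
    case East
    with Cons.prems have "north_steps L (i - 1) > 0" "i - 1 \<le> count_list L East"
      by auto
    from Cons.IH[OF this] obtain u v
      where "L = u @ North # East # v" "count_list u East + 1 = i - 1" by blast
    then show ?thesis
      using East by (intro exI[of _ "East # u"] exI[of _ v]) auto
  next
    case North
    show ?thesis
    proof (cases "north_steps L i > 0")
      case True
      with Cons.IH[of i] Cons.prems North obtain u v
        where "L = u @ North # East # v" "count_list u East + 1 = i" by auto
      then show ?thesis
        using North by (intro exI[of _ "North # u"] exI[of _ v]) auto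
    next
      case False
      with Cons.prems North have i: "i = 1" by (simp split: if_splits)
      from Cons.prems North i have "L \<noteq> []" by auto
      then obtain t v where L: "L = t # v" by (cases L) auto
      with False i have "t = East" by (cases t) auto
      with L i North show ?thesis
        by (intro exI[of _ "[]"] exI[of _ v]) auto
    qed
  qed
qed simp

section \<open>Shifted families of sets\<close>

text \<open>A shift from \<open>p\<close> to \<open>q\<close> can be routed through \<open>q - 1\<close>: if this place is vacant, the element
  \<open>p\<close> travels over it; if it is occupied, its occupant moves to \<open>q\<close> first and \<open>p\<close> takes its
  place.\<close>

lemma shifted_family_iff_adjacent:
  "shifted_family n A \<longleftrightarrow> A \<subseteq> Pow {1..n} \<and>
    (\<forall>F\<in>A. \<forall>p. p \<in> F \<and> Suc p \<notin> F \<and> Suc p \<le> n \<longrightarrow> insert (Suc p) (F - {p}) \<in> A)"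
  (is "_ \<longleftrightarrow> _ \<and> ?adj")
proof (intro iffI conjI)
  assume A: "shifted_family n A"
  then show "A \<subseteq> Pow {1..n}" by (simp add: shifted_family_def)
  show ?adj
  proof (intro ballI allI impI)
    fix F p assume F: "F \<in> A" "p \<in> F \<and> Suc p \<notin> F \<and> Suc p \<le> n"
    with A have "p \<in> {1..n}" unfolding shifted_family_def by blast
    moreover from F have "Suc p \<in> {1..n}" by simp
    ultimately show "insert (Suc p) (F - {p}) \<in> A"
      using A F
      unfolding shifted_family_def using lessI by blast
  qed
next
  assume *: "A \<subseteq> Pow {1..n} \<and> ?adj"
  then have adj: "insert (Suc p) (F - {p}) \<in> A"
    if "F \<in> A" "p \<in> F" "Suc p \<notin> F" "Suc p \<le> n" for F p
    using that by blast
  have "insert q (F - {p}) \<in> A" if "F \<in> A" "p \<in> F" "q \<notin> F" "q \<le> n" "p < q" for F p q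
    using that
  proof (induction q arbitrary: F)
    case (Suc q)
    consider "p = q" | "p < q" "q \<notin> F" | "p < q" "q \<in> F"
      using Suc.prems(5) by linarith
    then show ?case
    proof cases
      case 1
      with Suc.prems adj show ?thesis by blast
    next
      case 2
      with Suc have "insert q (F - {p}) \<in> A" by simp
      then have "insert (Suc q) (insert q (F - {p}) - {q}) \<in> A"
        using Suc.prems by (intro adj) auto
      also have "insert (Suc q) (insert q (F - {p}) - {q}) = insert (Suc q) (F - {p})"
        using 2 by auto
      finally show ?thesis .
    next
      case 3
      with Suc.prems adj have "insert (Suc q) (F - {q}) \<in> A" by blast
      then have "insert q (insert (Suc q) (F - {q}) - {p}) \<in> A"
        using Suc.prems 3 by (intro Suc.IH) auto
      also have "insert q (insert (Suc q) (F - {q}) - {p}) = insert (Suc q) (F - {p})"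
        using 3 Suc.prems(5) by auto
      finally show ?thesis .
    qed
  qed simp
  with * show "shifted_family n A" by (auto simp: shifted_family_def)
qed

lemma shifted_family_nu_iff:
  assumes "P \<subseteq> lattice_paths r a"
  shows "shifted_family (r + a) (nu ` P) \<longleftrightarrow> flip_closed P"
proof
  assume shifted: "shifted_family (r + a) (nu ` P)"
  show "flip_closed P"
    unfolding flip_closed_def
  proof (intro ballI allI impI)
    fix L L' assume L: "L \<in> P" "flip L L'"
    then obtain u v where uv: "L = u @ North # East # v" "L' = u @ East # North # v"
      by (auto simp: flip_def)
    have paths: "L \<in> lattice_paths r a" "L' \<in> lattice_paths r a"
      using L assms flip_lattice_paths by blast+
    have "Suc (length u) \<in> nu L" "Suc (Suc (length u)) \<notin> nu L" "Suc (Suc (length u)) \<le> r + a"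
      using paths(1) by (auto simp: uv(1) nu_def nth_append lattice_paths_def)
    with shifted L(1) have "nu L' \<in> nu ` P"
      unfolding shifted_family_iff_adjacent uv(2) nu_flip uv(1) by blast
    then obtain L'' where "L'' \<in> P" "nu L' = nu L''" by blast
    moreover from this have "L' = L''"
      using paths(2) assms bij_betw_nu[of r a] by (blast dest: bij_betw_imp_inj_on inj_onD)
    ultimately show "L' \<in> P" by simp
  qed
next
  assume closed: "flip_closed P"
  have "insert (Suc p) (nu L - {p}) \<in> nu ` P"
    if L: "L \<in> P" "p \<in> nu L" "Suc p \<notin> nu L" "Suc p \<le> r + a" for L p
  proof -
    from L(1) assms have "length L = r + a" by (auto simp: lattice_paths_def)
    with L(2-4) obtain u v where uv: "L = u @ North # East # v" "length u + 1 = p"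
      using path_split_nu[of p L] by metis
    then have "u @ East # North # v \<in> P"
      using closed L(1) by (auto simp: flip_closed_def flip_def)
    moreover have "nu (u @ East # North # v) = insert (Suc p) (nu L - {p})"
      using nu_flip[of u v] uv by simp
    ultimately show ?thesis by (metis imageI)
  qed
  moreover have "nu L \<subseteq> {1..r + a}" if "L \<in> P" for L
    using subsetD[OF assms that] nu_subset[of L] by (simp add: lattice_paths_def)
  ultimately show "shifted_family (r + a) (nu ` P)"
    unfolding shifted_family_iff_adjacent by blast
qed

section \<open>Shifted multicomplexes\<close>

text \<open>Passage to the next variable, where the variable after the last one is \<open>1\<close>.\<close>

definition raise :: "nat \<Rightarrow> nat \<Rightarrow> nat multiset \<Rightarrow> nat multiset" where
  "raise r i m = (m - {#i#}) + (if i < r then {#Suc i#} else {#})"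

text \<open>Iterating \<open>raise\<close> on one factor moves it to any later variable, and finally past the last
  one, which divides it out; dividing out factors one at a time yields all divisors.\<close>

lemma shifted_multicomplex_iff_raise:
  "shifted_multicomplex r M \<longleftrightarrow> M \<subseteq> monomials r \<and> (\<forall>m\<in>M. \<forall>i. i \<in># m \<longrightarrow> raise r i m \<in> M)"
  (is "_ \<longleftrightarrow> _ \<and> ?raise")
proof (intro iffI conjI)
  assume M: "shifted_multicomplex r M"
  then show sub: "M \<subseteq> monomials r"
    by (simp add: shifted_multicomplex_def multicomplex_def)
  show ?raise
  proof (intro ballI allI impI)
    fix m i assume m: "m \<in> M" "i \<in># m"
    with sub have i: "i \<in> {1..r}" unfolding monomials_def by blast
    show "raise r i m \<in> M"
    proof (cases "i < r")
      case True
      then have "Suc i \<in> {1..r}" by simp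
      with M m i have "add_mset (Suc i) (m - {#i#}) \<in> M"
        unfolding shifted_multicomplex_def using lessI by blast
      with True show ?thesis by (simp add: raise_def)
    next
      case False
      moreover have "m - {#i#} \<in> M"
        using M m(1) diff_subset_eq_self
        unfolding shifted_multicomplex_def multicomplex_def by blast
      ultimately show ?thesis by (simp add: raise_def)
    qed
  qed
next
  assume "M \<subseteq> monomials r \<and> ?raise"
  then have sub: "M \<subseteq> monomials r"
    and raise: "\<And>m i. m \<in> M \<Longrightarrow> i \<in># m \<Longrightarrow> raise r i m \<in> M" by auto
  have shift: "add_mset q (m - {#p#}) \<in> M" if "m \<in> M" "p \<in># m" "p < q" "q \<le> r" for m p q
    using that(3,1,2,4)
  proof (induction q)
    case (Suc q)
    show ?case
    proof (cases "p = q")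
      case True
      with Suc.prems raise[of m p] show ?thesis by (simp add: raise_def)
    next
      case False
      with Suc have "add_mset q (m - {#p#}) \<in> M" by simp
      from raise[OF this, of q] Suc.prems show ?thesis by (simp add: raise_def)
    qed
  qed simp
  have divide: "m - {#p#} \<in> M" if "m \<in> M" "p \<in># m" for m p
  proof (cases "p < r")
    case True
    with shift that have "add_mset r (m - {#p#}) \<in> M" by simp
    from raise[OF this, of r] show ?thesis by (simp add: raise_def)
  next
    case False
    with raise[OF that] show ?thesis by (simp add: raise_def)
  qed
  have "m' \<in> M" if "m' + k \<in> M" for m' k
    using that
  proof (induction k)
    case (add x k)
    from divide[OF add.prems, of x] have "m' + k \<in> M" by simp
    then show ?case by (rule add.IH)
  qed simp
  then have "multicomplex r M"
    using sub by (auto simp: multicomplex_def subset_mset.le_iff_add)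
  with shift show "shifted_multicomplex r M"
    by (simp add: shifted_multicomplex_def)
qed

lemma lambda_flip:
  assumes "count_list (u @ v) East + 1 = r"
  shows "lambda r (u @ East # North # v)
    = raise r (count_list u East + 1) (lambda r (u @ North # East # v))"
proof (rule multiset_eqI)
  fix i
  show "count (lambda r (u @ East # North # v)) i
    = count (raise r (count_list u East + 1) (lambda r (u @ North # East # v))) i"
    using assms by (auto simp: raise_def count_lambda north_steps_append)
qed

lemma shifted_multicomplex_lambda_iff:
  assumes "P \<subseteq> lattice_paths r a"
  shows "shifted_multicomplex r (lambda r ` P) \<longleftrightarrow> flip_closed P"
proof
  assume shifted: "shifted_multicomplex r (lambda r ` P)"
  show "flip_closed P"
    unfolding flip_closed_def
  proof (intro ballI allI impI)
    fix L L' assume L: "L \<in> P" "flip L L'"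
    then obtain u v where uv: "L = u @ North # East # v" "L' = u @ East # North # v"
      by (auto simp: flip_def)
    let ?i = "count_list u East + 1"
    have paths: "L \<in> lattice_paths r a" "L' \<in> lattice_paths r a"
      using L assms flip_lattice_paths by blast+
    then have East: "count_list (u @ v) East + 1 = r"
      using lattice_paths_count_East[of L] uv by simp
    then have "?i \<in># lambda r L"
      by (simp add: uv(1) count_lambda north_steps_append flip: count_greater_zero_iff)
    with shifted L(1) have "raise r ?i (lambda r L) \<in> lambda r ` P"
      unfolding shifted_multicomplex_iff_raise by blast
    with lambda_flip[OF East] have "lambda r L' \<in> lambda r ` P"
      by (simp add: uv)
    then obtain L'' where "L'' \<in> P" "lambda r L' = lambda r L''" by blast
    moreover from this have "L' = L''"
      using paths(2) assms bij_betw_lambda[of r a] by (blast dest: bij_betw_imp_inj_on inj_onD)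
    ultimately show "L' \<in> P" by simp
  qed
next
  assume closed: "flip_closed P"
  have "raise r i (lambda r L) \<in> lambda r ` P" if L: "L \<in> P" "i \<in># lambda r L" for L i
  proof -
    from L(1) assms have East: "count_list L East = r"
      using lattice_paths_count_East by blast
    from L(2) have "north_steps L i > 0" "i \<le> r"
      by (auto simp: count_lambda split: if_splits simp flip: count_greater_zero_iff)
    with East obtain u v where uv: "L = u @ North # East # v" "count_list u East + 1 = i"
      using path_split_north_steps by blast
    then have "u @ East # North # v \<in> P"
      using closed L(1) by (auto simp: flip_closed_def flip_def)
    moreover have "lambda r (u @ East # North # v) = raise r i (lambda r L)"
      using lambda_flip[of u v r] uv East by simp
    ultimately show ?thesis by (metis imageI)
  qed
  moreover have "lambda r L \<in> monomials r" if "L \<in> P" for L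
    using that assms bij_betwE[OF bij_betw_lambda[of r a]] by (auto simp: monomials_upto_def)
  ultimately show "shifted_multicomplex r (lambda r ` P)"
    unfolding shifted_multicomplex_iff_raise by blast
qed

section \<open>The bijection of shifted objects\<close>

lemma phi_lambda: "L \<in> lattice_paths r a \<Longrightarrow> phi r a (lambda r L) = nu L"
  by (simp add: phi_def inv_into_f_f[OF bij_betw_imp_inj_on[OF bij_betw_lambda]])

lemma psi_nu:
  assumes "L \<in> lattice_paths r a"
  shows "psi r a (nu L) = lambda r L"
  using assms bij_betwE[OF bij_betw_lambda[of r a]] bij_betw_imp_inj_on[OF bij_betw_phi[of r a]]
  by (simp add: psi_def inv_into_f_f flip: phi_lambda)

lemma phi_bar_lambda: "P \<subseteq> lattice_paths r a \<Longrightarrow> phi_bar r a (lambda r ` P) = nu ` P"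
  unfolding phi_bar_def image_image by (intro image_cong refl phi_lambda) blast

lemma psi_bar_nu: "P \<subseteq> lattice_paths r a \<Longrightarrow> psi_bar r a (nu ` P) = lambda r ` P"
  unfolding psi_bar_def image_image by (intro image_cong refl psi_nu) blast

lemma shifted_multicomplexes_upto_eq:
  "shifted_multicomplexes_upto r a
    = (`) (lambda r) ` {P. P \<subseteq> lattice_paths r a \<and> flip_closed P}"
proof (intro set_eqI iffI)
  fix M assume M: "M \<in> shifted_multicomplexes_upto r a"
  then have "M \<subseteq> lambda r ` lattice_paths r a"
    using bij_betw_imp_surj_on[OF bij_betw_lambda[of r a]]
    by (auto simp: shifted_multicomplexes_upto_def shifted_multicomplex_def multicomplex_def
        monomials_upto_def)
  then obtain P where "P \<subseteq> lattice_paths r a" "M = lambda r ` P"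
    by (auto simp: subset_image_iff)
  with M show "M \<in> (`) (lambda r) ` {P. P \<subseteq> lattice_paths r a \<and> flip_closed P}"
    by (auto simp: shifted_multicomplexes_upto_def shifted_multicomplex_lambda_iff)
next
  fix M assume "M \<in> (`) (lambda r) ` {P. P \<subseteq> lattice_paths r a \<and> flip_closed P}"
  then show "M \<in> shifted_multicomplexes_upto r a"
    using bij_betwE[OF bij_betw_lambda[of r a]]
    by (auto simp: shifted_multicomplexes_upto_def shifted_multicomplex_lambda_iff
        monomials_upto_def)
qed

lemma shifted_families_of_card_eq:
  "shifted_families_of_card (r + a) a
    = (`) nu ` {P. P \<subseteq> lattice_paths r a \<and> flip_closed P}"
proof (intro set_eqI iffI)
  fix A assume A: "A \<in> shifted_families_of_card (r + a) a"
  then have "A \<subseteq> nu ` lattice_paths r a"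
    using bij_betw_imp_surj_on[OF bij_betw_nu[of r a]]
    by (auto simp: shifted_families_of_card_def)
  then obtain P where "P \<subseteq> lattice_paths r a" "A = nu ` P"
    by (auto simp: subset_image_iff)
  with A show "A \<in> (`) nu ` {P. P \<subseteq> lattice_paths r a \<and> flip_closed P}"
    by (auto simp: shifted_families_of_card_def shifted_family_nu_iff)
next
  fix A assume "A \<in> (`) nu ` {P. P \<subseteq> lattice_paths r a \<and> flip_closed P}"
  then show "A \<in> shifted_families_of_card (r + a) a"
    using bij_betwE[OF bij_betw_nu[of r a]]
    by (auto simp: shifted_families_of_card_def shifted_family_nu_iff)
qed

section \<open>Interval partition of a pure shifted complex\<close>

text \<open>The elements that can be exchanged for a larger vacant one. For a facet \<open>F\<close> of a pure
  shifted complex this is the smallest face of \<open>F\<close> that is new when the facets are listed from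
  the largest sets down.\<close>

definition restriction :: "nat \<Rightarrow> nat set \<Rightarrow> nat set" where
  "restriction n F = {j \<in> F. \<not> {j..n} \<subseteq> F}"

lemma finite_simplicial_complex:
  assumes "simplicial_complex n \<Delta>"
  shows "finite \<Delta>" and "F \<in> \<Delta> \<Longrightarrow> finite F"
proof -
  have "\<Delta> \<subseteq> Pow {1..n}" using assms by (simp add: simplicial_complex_def)
  then show "finite \<Delta>" and "F \<in> \<Delta> \<Longrightarrow> finite F"
    by (auto intro: finite_subset)
qed

lemma face_subset_facet:
  assumes "simplicial_complex n \<Delta>" "G \<in> \<Delta>"
  shows "\<exists>F\<in>facets \<Delta>. G \<subseteq> F"
proof -
  obtain F where "F \<in> \<Delta>" "G \<subseteq> F" "\<forall>H\<in>\<Delta>. F \<subseteq> H \<longrightarrow> F = H"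
    using finite_has_maximal2[OF finite_simplicial_complex(1)[OF assms(1)] assms(2)] by blast
  then show ?thesis unfolding facets_def by blast
qed

lemma facets_eq_faces_of_card:
  assumes "simplicial_complex n \<Delta>" "pure_complex a \<Delta>"
  shows "facets \<Delta> = {F \<in> \<Delta>. card F = a}"
proof (intro set_eqI iffI)
  fix F assume "F \<in> facets \<Delta>"
  with assms(2) show "F \<in> {F \<in> \<Delta>. card F = a}"
    by (simp add: pure_complex_def facets_def)
next
  fix F assume F: "F \<in> {F \<in> \<Delta>. card F = a}"
  then obtain F' where F': "F' \<in> facets \<Delta>" "F \<subseteq> F'"
    using face_subset_facet[OF assms(1)] by blast
  then have "card F' = a" "finite F'"
    using assms finite_simplicial_complex(2)[OF assms(1)]
    by (auto simp: pure_complex_def facets_def)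
  with F F' show "F \<in> facets \<Delta>"
    using card_subset_eq[of F' F] by simp
qed

text \<open>Filling up a face \<open>G\<close> with the largest elements cannot leave the complex: as long as a
  face containing \<open>G\<close> differs from the desired set, one of its elements outside that set can be
  shifted up to a missing one.\<close>

lemma shifted_family_fill_up:
  assumes "shifted_family n A" "F' \<in> A" "G \<subseteq> F'"
    and "G \<subseteq> {1..n}" "card F' = card (G \<union> {s<..n})"
  shows "G \<union> {s<..n} \<in> A"
  using assms(2,3,5)
proof (induction "card (G \<union> {s<..n} - F')" arbitrary: F' rule: less_induct)
  case less
  let ?F = "G \<union> {s<..n}"
  have sub: "?F \<subseteq> {1..n}" using assms(4) by auto
  then have fin: "finite ?F" by (rule finite_subset) simp
  have sub': "F' \<subseteq> {1..n}" using assms(1) less.prems(1) by (auto simp: shifted_family_def)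
  then have fin': "finite F'" by (rule finite_subset) simp
  show ?case
  proof (cases "?F \<subseteq> F'")
    case True
    with less.prems fin' have "?F = F'" by (intro card_subset_eq) auto
    with less.prems(1) show ?thesis by simp
  next
    case False
    then obtain y where y: "y \<in> ?F" "y \<notin> F'" by blast
    have "\<not> F' \<subseteq> ?F"
      using card_subset_eq[OF fin, of F'] less.prems(3) y by auto
    then obtain x where x: "x \<in> F'" "x \<notin> ?F" by blast
    define F'' where "F'' = insert y (F' - {x})"
    \<comment> \<open>Both \<open>x\<close> and \<open>y\<close> are outside \<open>G\<close>, hence on different sides of \<open>s\<close>.\<close>
    have "x < y" "x \<in> {1..n}" "y \<in> {1..n}"
      using x y sub sub' less.prems(2) by auto
    with x y assms(1) less.prems(1) have "F'' \<in> A"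
      unfolding F''_def shifted_family_def by blast
    moreover have "G \<subseteq> F''"
      using less.prems(2) x by (auto simp: F''_def)
    moreover have "card F'' = card ?F"
      using x y fin' less.prems(3) card_Suc_Diff1[OF fin' x(1)] by (simp add: F''_def)
    moreover have "card (?F - F'') < card (?F - F')"
    proof (rule psubset_card_mono)
      show "?F - F'' \<subset> ?F - F'" using x y unfolding F''_def by blast
    qed (use fin in simp)
    ultimately show ?thesis using less.hyps[of F''] by simp
  qed
qed

text \<open>Lowering \<open>s\<close> by one adds at most one element, so no cardinality between \<open>card G\<close> and \<open>n\<close> is
  skipped.\<close>

lemma ex_fill_up_card:
  assumes "G \<subseteq> {1..n}" "card G \<le> a" "a \<le> n"
  shows "\<exists>s. card (G \<union> {s<..n}) = a"
proof -
  define s where "s = (LEAST s. card (G \<union> {s<..n}) \<le> a)"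
  have "card (G \<union> {n<..n}) \<le> a" using assms(2) by simp
  then have le: "card (G \<union> {s<..n}) \<le> a"
    unfolding s_def by (rule LeastI)
  have "card (G \<union> {s<..n}) \<ge> a"
  proof (cases s)
    case 0
    have "G \<union> {0<..n} = {1..n}" using assms(1) by auto
    with 0 assms(3) show ?thesis by simp
  next
    case (Suc t)
    then have "\<not> card (G \<union> {t<..n}) \<le> a"
      using not_less_Least[of t "\<lambda>s. card (G \<union> {s<..n}) \<le> a"] by (simp add: s_def)
    moreover have "card (G \<union> {t<..n}) \<le> card (insert s (G \<union> {s<..n}))"
      using finite_subset[OF assms(1)] Suc by (intro card_mono) auto
    moreover have "\<dots> \<le> Suc (card (G \<union> {s<..n}))"
      by (rule card_insert_le_m1) auto
    ultimately show ?thesis by linarith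
  qed
  with le show ?thesis by auto
qed

text \<open>For uniqueness, let facets \<open>F\<close> and \<open>F'\<close> both qualify. An element of \<open>F - F'\<close> is not in \<open>G\<close>,
  so all larger elements of the ground set belong to \<open>F\<close>, and it exceeds every element of
  \<open>F' - F\<close>. By symmetry one of the two differences is empty, and the sets agree by cardinality.\<close>

lemma ex1_facet_interval:
  assumes "shifted_complex n \<Delta>" "pure_complex a \<Delta>" "a \<le> n" "G \<in> \<Delta>"
  shows "\<exists>!F. F \<in> facets \<Delta> \<and> restriction n F \<subseteq> G \<and> G \<subseteq> F"
proof -
  have complex: "simplicial_complex n \<Delta>" and shifted: "shifted_family n \<Delta>"
    using assms(1) by (simp_all add: shifted_complex_def)
  note facets = facets_eq_faces_of_card[OF complex assms(2)]
  note fin = finite_simplicial_complex(2)[OF complex]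
  have G: "G \<subseteq> {1..n}" using complex assms(4) by (auto simp: simplicial_complex_def)
  obtain F' where F': "F' \<in> \<Delta>" "card F' = a" "G \<subseteq> F'"
    using face_subset_facet[OF complex assms(4)] facets by auto
  then have "card G \<le> a" using card_mono[OF fin[OF F'(1)]] by blast
  then obtain s where s: "card (G \<union> {s<..n}) = a"
    using ex_fill_up_card[OF G] assms(3) by blast
  have "G \<union> {s<..n} \<in> facets \<Delta>"
    using shifted_family_fill_up[OF shifted F'(1,3) G] F'(2) s facets by simp
  moreover have "restriction n (G \<union> {s<..n}) \<subseteq> G"
    by (auto simp: restriction_def)
  moreover have "F1 = F2"
    if F1: "F1 \<in> facets \<Delta>" "restriction n F1 \<subseteq> G" "G \<subseteq> F1"
      and F2: "F2 \<in> facets \<Delta>" "restriction n F2 \<subseteq> G" "G \<subseteq> F2" for F1 F2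
  proof -
    have faces: "F1 \<in> \<Delta>" "F2 \<in> \<Delta>" "card F1 = a" "card F2 = a"
      using F1(1) F2(1) facets by auto
    have sub: "F1 \<subseteq> {1..n}" "F2 \<subseteq> {1..n}"
      using complex faces by (auto simp: simplicial_complex_def)
    have "F1 \<subseteq> F2 \<or> F2 \<subseteq> F1"
    proof (rule ccontr)
      assume "\<not> (F1 \<subseteq> F2 \<or> F2 \<subseteq> F1)"
      then obtain x y where xy: "x \<in> F1" "x \<notin> F2" "y \<in> F2" "y \<notin> F1" by blast
      then have "{x..n} \<subseteq> F1" "{y..n} \<subseteq> F2"
        using F1 F2 by (auto simp: restriction_def)
      moreover have "x \<le> n" "y \<le> n" using xy sub by auto
      ultimately have "\<not> x \<le> y" "\<not> y \<le> x" using xy by auto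
      then show False by linarith
    qed
    then show ?thesis
      using card_subset_eq[OF fin] faces by metis
  qed
  ultimately show ?thesis by blast
qed

section \<open>The h-vector\<close>

lemma h_polynomial_eq_sum_faces:
  assumes "finite \<Delta>" "\<And>G. G \<in> \<Delta> \<Longrightarrow> card G \<le> a"
  shows "h_polynomial a \<Delta> = (\<Sum>G\<in>\<Delta>. [:1, -1:] ^ (a - card G) * [:0, 1:] ^ card G)"
proof -
  have "h_polynomial a \<Delta>
      = (\<Sum>i=0..a. \<Sum>G | G \<in> \<Delta> \<and> card G = i. [:1, -1:] ^ (a - card G) * [:0, 1:] ^ card G)"
    unfolding h_polynomial_def face_count_def
    by (intro sum.cong refl) (simp add: mult.assoc)
  also have "\<dots> = (\<Sum>G\<in>\<Delta>. [:1, -1:] ^ (a - card G) * [:0, 1:] ^ card G)"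
    using assms by (intro sum.group) auto
  finally show ?thesis .
qed

text \<open>After \<open>y ^ card R\<close> is factored out, the remaining sum over the subsets of \<open>F - R\<close> is the
  expansion of \<open>(y + (1 - y)) ^ card (F - R) = 1\<close>.\<close>

lemma sum_interval:
  assumes "finite F" "R \<subseteq> F"
  shows "(\<Sum>G | R \<subseteq> G \<and> G \<subseteq> F. [:1, -1 :: int:] ^ (card F - card G) * [:0, 1:] ^ card G)
    = [:0, 1:] ^ card R"
proof -
  let ?y = "[:0, 1 :: int:]" and ?z = "[:1, -1 :: int:]"
  have finR: "finite R" using assms finite_subset by blast
  have "(\<Sum>G | R \<subseteq> G \<and> G \<subseteq> F. ?z ^ (card F - card G) * ?y ^ card G)
      = (\<Sum>H\<in>Pow (F - R). ?y ^ card R * (?y ^ card H * ?z ^ card (F - R - H)))"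
  proof (rule sum.reindex_bij_witness[of _ "\<lambda>H. R \<union> H" "\<lambda>G. G - R"])
    fix G assume "G \<in> {G. R \<subseteq> G \<and> G \<subseteq> F}"
    then have G: "R \<subseteq> G" "G \<subseteq> F" "finite G" using assms finite_subset by auto
    have "F - R - (G - R) = F - G" using G by auto
    moreover have "card (F - G) = card F - card G" using G by (simp add: card_Diff_subset)
    moreover have "card G = card R + card (G - R)"
      using G finR card_mono[of G R] by (simp add: card_Diff_subset)
    ultimately show "?y ^ card R * (?y ^ card (G - R) * ?z ^ card (F - R - (G - R)))
        = ?z ^ (card F - card G) * ?y ^ card G"
      by (simp only: power_add mult_ac)
  qed (use assms in auto)
  also have "\<dots> = ?y ^ card R * (\<Sum>H\<in>Pow (F - R). ?y ^ card H * ?z ^ card (F - R - H))"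
    by (simp only: sum_distrib_left)
  also have "(\<Sum>H\<in>Pow (F - R). ?y ^ card H * ?z ^ card (F - R - H)) = (\<Prod>j\<in>F - R. ?y + ?z)"
    using prod_add[of "F - R" "\<lambda>_. ?y" "\<lambda>_. ?z"] assms(1)
    by (simp only: finite_Diff prod_constant)
  also have "?y + ?z = 1" by (simp add: one_pCons)
  finally show ?thesis by simp
qed

lemma h_vector_eq_card_restriction:
  assumes "shifted_complex n \<Delta>" "pure_complex a \<Delta>" "a \<le> n"
  shows "h_vector a \<Delta> i = int (card {F \<in> facets \<Delta>. card (restriction n F) = i})"
proof -
  have complex: "simplicial_complex n \<Delta>"
    using assms(1) by (simp add: shifted_complex_def)
  note facets = facets_eq_faces_of_card[OF complex assms(2)]
  note fin = finite_simplicial_complex[OF complex]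
  define I where "I F = {G. restriction n F \<subseteq> G \<and> G \<subseteq> F}" for F
  let ?t = "\<lambda>G. [:1, -1 :: int:] ^ (a - card G) * [:0, 1:] ^ card G"
  have finI: "finite (I F)" if "F \<in> facets \<Delta>" for F
    using that fin(2)[of F] by (auto simp: facets I_def intro: finite_subset[of _ "Pow F"])
  have finF: "finite (facets \<Delta>)" using fin(1) by (simp add: facets)
  have union: "\<Delta> = (\<Union>F\<in>facets \<Delta>. I F)"
  proof (intro equalityI subsetI)
    fix G assume "G \<in> \<Delta>"
    from ex1_implies_ex[OF ex1_facet_interval[OF assms this]]
    show "G \<in> (\<Union>F\<in>facets \<Delta>. I F)" by (auto simp: I_def)
  next
    fix G assume "G \<in> (\<Union>F\<in>facets \<Delta>. I F)"
    then show "G \<in> \<Delta>"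
      using complex by (auto simp: I_def facets simplicial_complex_def)
  qed
  have disjoint: "I F \<inter> I F' = {}" if "F \<in> facets \<Delta>" "F' \<in> facets \<Delta>" "F \<noteq> F'" for F F'
  proof (rule ccontr)
    assume "I F \<inter> I F' \<noteq> {}"
    then obtain G where G: "G \<in> I F" "G \<in> I F'" by blast
    with that(1) union have "G \<in> \<Delta>" by blast
    with G that show False
      using ex1_facet_interval[OF assms, of G] unfolding I_def
      by (metis (no_types, lifting) mem_Collect_eq)
  qed
  have "card G \<le> a" if "G \<in> \<Delta>" for G
    using face_subset_facet[OF complex that] card_mono[OF fin(2)] by (auto simp: facets)
  then have "h_polynomial a \<Delta> = (\<Sum>G\<in>\<Delta>. ?t G)"
    by (rule h_polynomial_eq_sum_faces[OF fin(1)])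
  also have "\<dots> = (\<Sum>F\<in>facets \<Delta>. \<Sum>G\<in>I F. ?t G)"
    using sum.UNION_disjoint[OF finF, of I ?t] finI disjoint union by simp
  also have "\<dots> = (\<Sum>F\<in>facets \<Delta>. [:0, 1:] ^ card (restriction n F))"
  proof (rule sum.cong[OF refl])
    fix F assume "F \<in> facets \<Delta>"
    then have "card F = a" "finite F" using fin(2) by (auto simp: facets)
    then show "(\<Sum>G\<in>I F. ?t G) = [:0, 1:] ^ card (restriction n F)"
      using sum_interval[of F "restriction n F"] by (auto simp: I_def restriction_def)
  qed
  also have "\<dots> = (\<Sum>F\<in>facets \<Delta>. monom 1 (card (restriction n F)))"
    by (simp add: monom_altdef)
  finally have "h_vector a \<Delta> i
      = (\<Sum>F\<in>facets \<Delta>. if card (restriction n F) = i then 1 else 0)"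
    by (simp add: h_vector_def coeff_sum)
  also have "\<dots> = int (card {F \<in> facets \<Delta>. card (restriction n F) = i})"
    using finF by (simp add: sum.If_cases Int_def)
  finally show ?thesis .
qed

text \<open>A north step lies on the line \<open>x = r\<close> iff no east step follows it, that is, iff its
  position starts a final segment contained in \<open>nu L\<close>.\<close>

lemma size_lambda_eq_card_restriction:
  assumes "L \<in> lattice_paths r a"
  shows "size (lambda r L) = card (restriction (r + a) (nu L))"
proof -
  have len: "length L = r + a" and East: "count_list L East = r"
    using assms lattice_paths_count_East by (auto simp: lattice_paths_def)
  let ?final = "{j \<in> nu L. {j..r + a} \<subseteq> nu L}"
  have last: "count_list (take k L) East + 1 = Suc r \<longleftrightarrow> {Suc k..r + a} \<subseteq> nu L"
    if k: "k < length L" for k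
  proof -
    have "count_list (take k L) East + count_list (drop k L) East = r"
      using count_list_append[of "take k L" "drop k L" East] East by simp
    then have "count_list (take k L) East + 1 = Suc r \<longleftrightarrow> East \<notin> set (drop k L)"
      by (auto simp: count_list_0_iff)
    also have "\<dots> \<longleftrightarrow> (\<forall>i<length L - k. L ! (k + i) = North)"
      by (auto simp: in_set_conv_nth intro: step.exhaust)
    also have "\<dots> \<longleftrightarrow> {Suc k..r + a} \<subseteq> nu L"
    proof (intro iffI subsetI allI impI)
      fix j assume "\<forall>i<length L - k. L ! (k + i) = North" "j \<in> {Suc k..r + a}"
      then show "j \<in> nu L" using len by (auto simp: nu_def dest!: spec[of _ "j - 1 - k"])
    next
      fix i assume "{Suc k..r + a} \<subseteq> nu L" "i < length L - k"
      then have "Suc (k + i) \<in> nu L" using len by auto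
      then show "L ! (k + i) = North" by (simp add: nu_def)
    qed
    finally show ?thesis .
  qed
  have "?final = Suc ` {k. k < length L \<and> L ! k = North \<and> {Suc k..r + a} \<subseteq> nu L}"
    by (force simp: nu_def image_iff Suc_le_eq gr0_conv_Suc)
  also have "{k. k < length L \<and> L ! k = North \<and> {Suc k..r + a} \<subseteq> nu L}
      = {k. k < length L \<and> L ! k = North \<and> count_list (take k L) East + 1 = Suc r}"
    using last by blast
  finally have "card ?final = north_steps L (Suc r)"
    by (simp add: card_image north_steps_def)
  moreover have "card (restriction (r + a) (nu L)) + card ?final = card (nu L)"
    using finite_subset[OF nu_subset]
    by (subst card_Un_disjoint[symmetric]) (auto simp: restriction_def intro: arg_cong[of _ _ card])
  moreover have "card (nu L) = a"
    using assms by (simp add: card_nu lattice_paths_def)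
  ultimately show ?thesis
    using lambda_size_add[OF assms] by linarith
qed

theorem proposition6:
  fixes r a :: nat
  assumes "a \<ge> 1"
  shows
    "(bij_betw (phi_bar r a)
        (shifted_multicomplexes_upto r a) (shifted_families_of_card (r + a) a)
      \<and> bij_betw (psi_bar r a)
        (shifted_families_of_card (r + a) a) (shifted_multicomplexes_upto r a)
      \<and> (\<forall>M \<in> shifted_multicomplexes_upto r a. psi_bar r a (phi_bar r a M) = M)
      \<and> (\<forall>A \<in> shifted_families_of_card (r + a) a. phi_bar r a (psi_bar r a A) = A))
    \<and> (\<forall>\<Delta>. shifted_complex (r + a) \<Delta> \<and> pure_complex a \<Delta> \<longrightarrow>
        (\<forall>i\<le>a. h_vector a \<Delta> i = int (f_vector (psi_bar r a (facets \<Delta>)) i)))"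
proof (intro conjI allI impI)
  let ?MM = "shifted_multicomplexes_upto r a" and ?FF = "shifted_families_of_card (r + a) a"
  show psi_phi: "\<forall>M \<in> ?MM. psi_bar r a (phi_bar r a M) = M"
    by (auto simp: shifted_multicomplexes_upto_eq phi_bar_lambda psi_bar_nu)
  show phi_psi: "\<forall>A \<in> ?FF. phi_bar r a (psi_bar r a A) = A"
    by (auto simp: shifted_families_of_card_eq phi_bar_lambda psi_bar_nu)
  have phi: "phi_bar r a ` ?MM \<subseteq> ?FF"
    by (auto simp: shifted_multicomplexes_upto_eq shifted_families_of_card_eq phi_bar_lambda)
  have psi: "psi_bar r a ` ?FF \<subseteq> ?MM"
    by (auto simp: shifted_multicomplexes_upto_eq shifted_families_of_card_eq psi_bar_nu)
  show "bij_betw (phi_bar r a) ?MM ?FF"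
    using psi_phi phi_psi phi psi by (rule bij_betw_byWitness)
  show "bij_betw (psi_bar r a) ?FF ?MM"
    using phi_psi psi_phi psi phi by (rule bij_betw_byWitness)
next
  fix \<Delta> i assume \<Delta>: "shifted_complex (r + a) \<Delta> \<and> pure_complex a \<Delta>" and "i \<le> a"
  then have "simplicial_complex (r + a) \<Delta>" by (simp add: shifted_complex_def)
  then have "facets \<Delta> \<subseteq> subsets_of_card (r + a) a"
    using facets_eq_faces_of_card[of "r + a" \<Delta> a] \<Delta>
    by (auto simp: simplicial_complex_def subsets_of_card_def)
  then obtain P where P: "P \<subseteq> lattice_paths r a" "facets \<Delta> = nu ` P"
    using bij_betw_imp_surj_on[OF bij_betw_nu[of r a]] by (metis subset_image_iff)
  have inj: "inj_on nu P" "inj_on (lambda r) P"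
    using P(1) bij_betw_nu[of r a] bij_betw_lambda[of r a]
    by (meson bij_betw_imp_inj_on inj_on_subset)+
  let ?Q = "{L \<in> P. size (lambda r L) = i}"
  have "{F \<in> facets \<Delta>. card (restriction (r + a) F) = i} = nu ` ?Q"
    using P size_lambda_eq_card_restriction by fastforce
  moreover have "{m \<in> psi_bar r a (facets \<Delta>). size m = i} = lambda r ` ?Q"
    using psi_bar_nu[OF P(1)] P(2) by auto
  moreover have "card (nu ` ?Q) = card (lambda r ` ?Q)"
    using inj by (metis (no_types, lifting) card_image inj_on_subset mem_Collect_eq subsetI)
  ultimately show "h_vector a \<Delta> i = int (f_vector (psi_bar r a (facets \<Delta>)) i)"
    using h_vector_eq_card_restriction[of "r + a" \<Delta> a i] \<Delta> by (simp add: f_vector_def)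
qed

end
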